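(* Let $n$ be a nonnegative integer. Then the following identities hold: (i) $\displaystyle\sum_{k=0}^n\binom{n}{k}(-1)^k4^{n-k}S_k=\begin{cases}0&\text{if $n$ is odd,}\\ \binom{n}{n/2}^2&\text{if $n$ is even;}\end{cases}$ (ii) $\displaystyle\sum_{k=0}^n\binom{n}{k}(-1)^k\frac{S_k}{8^k}=\frac{S_n}{8^n};$ (iii) $\displaystyle\sum_{k=0}^n\binom{n}{k}\binom{n+k}{k}(-8)^{n-k}S_k=\begin{cases}0&\text{if $n$ is odd,}\\ (-1)^{n/2}\binom{n}{n/2}^3&\text{if $n$ is even.}\end{cases}$
   Context: For nonnegative integers $n$, $S_n=\sum_{k=0}^n\binom{n}{k}\binom{2k}{k}\binom{2n-2k}{n-k}$. *)

theory Defs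
  imports Complex_Main
begin

definition S :: "nat \<Rightarrow> nat" where
  "S n = (\<Sum>k=0..n. (n choose k) * ((2 * k) choose k) * ((2 * n - 2 * k) choose (n - k)))"

end

theory Submission
  imports Defs "HOL-Computational_Algebra.Polynomial" "HOL-Computational_Algebra.Formal_Power_Series"
begin

text \<open>
  Let \<open>c n\<close> be \<open>n choose (n div 2)\<close> for even \<open>n\<close> and \<open>0\<close> for odd \<open>n\<close>. The exponential
  generating function of \<open>(2n) choose n\<close> is \<open>e^(2x) I(x)\<close>, where \<open>I(x) = \<Sum>m. x^(2m) / m!^2\<close> is the
  generating function of \<open>c\<close>. The sequence \<open>S\<close> is the binomial convolution of the central
  binomial coefficients with themselves, so its generating function is \<open>e^(4x) I(x)^2\<close>. As the
  binomial convolution of \<open>c\<close> with itself is \<open>c^2\<close>, comparing coefficients gives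
  \<open>S n = \<Sum>k. (n choose k) 4^(n-k) (c k)^2\<close>, which is lemma \<open>S_binomial_sum\<close>.
  
  The numbers \<open>(c j)^2 / 4^j\<close> are moments: if \<open>X\<close> and \<open>Y\<close> are independent with the arcsine
  distribution on \<open>[-1, 1]\<close>, then \<open>c j / 2^j\<close> is the mean of \<open>X^j\<close> and \<open>(c j)^2 / 4^j\<close> that of
  \<open>t^j\<close>, where \<open>t = XY\<close>. Let \<open>L\<close> be the linear functional on polynomials with these
  moments. It is invariant under \<open>t \<mapsto> -t\<close>, and the formula for \<open>S\<close> says that
  \<open>S n / 4^n = L ((1+t)^n)\<close>, equivalently \<open>S n / 8^n = L (((1+t)/2)^n)\<close>. Every sum in the theorem
  is then a power of a constant times \<open>L\<close> of an explicit polynomial.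
  
  In the first identity this polynomial is \<open>(1 - (1+t))^n = (-t)^n\<close>, whose value is a moment. In
  the second one it is \<open>(1 - (1+t)/2)^n = ((1-t)/2)^n\<close>, which is the reflection of \<open>((1+t)/2)^n\<close>.
  
  In the third identity it is \<open>\<Sum>k. (n choose k) ((n+k) choose k) x^k\<close> at \<open>x = -(1+t)/2\<close>, that is,
  the Legendre polynomial \<open>P n\<close> at \<open>1 + 2x = -t\<close>. Rodrigues' formula gives its coefficients
  (\<open>coeff_legendre_centred\<close>). For odd \<open>n\<close> it is an odd polynomial and \<open>L\<close> annihilates it. For
  \<open>n = 2p\<close> the result is a terminating balanced hypergeometric sum \<open>3F2(-p, p+1/2, 1/2; 1, 1; 1)\<close>,
  an instance of the Pfaff-Saalschuetz theorem; it is evaluated in \<open>sum_saalschuetz_term\<close> by a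
  Wilf-Zeilberger recurrence in \<open>p\<close>.
\<close>

section \<open>Central binomial coefficients and their aerated sequence\<close>

definition aerated_central :: "nat \<Rightarrow> nat" where
  "aerated_central n = (if even n then n choose (n div 2) else 0)"

lemma coeff_shifted_square_power:
  fixes b :: "'a::comm_ring_1"
  shows "coeff ([:b, 0, 1:] ^ k) i = (if even i then of_nat (k choose (i div 2)) * b ^ (k - i div 2) else 0)"
proof -
  have "[:b, 0, 1:] ^ k = ([:b:] + monom 1 2) ^ k"
    by (simp add: numeral_2_eq_2 monom_Suc one_pCons)
  also have "\<dots> = (\<Sum>m\<le>k. of_nat (k choose m) * monom 1 2 ^ m * [:b:] ^ (k - m))"
    by (subst add.commute, subst binomial_ring) simp
  also have "\<dots> = (\<Sum>m\<le>k. monom (of_nat (k choose m) * b ^ (k - m)) (2 * m))"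
    by (intro sum.cong refl)
      (simp add: monom_power poly_const_pow of_nat_poly smult_monom mult.commute)
  finally have "coeff ([:b, 0, 1:] ^ k) i
      = (\<Sum>m\<le>k. if 2 * m = i then of_nat (k choose m) * b ^ (k - m) else 0)"
    by (simp add: coeff_sum)
  also have "\<dots> = (if even i then of_nat (k choose (i div 2)) * b ^ (k - i div 2) else 0)"
  proof (cases "even i")
    case True
    then obtain h where h: "i = 2 * h" by blast
    have "(\<Sum>m\<le>k. if 2 * m = i then of_nat (k choose m) * b ^ (k - m) else 0)
        = (\<Sum>m\<le>k. if m = h then of_nat (k choose m) * b ^ (k - m) else 0)"
      unfolding h by (intro sum.cong) auto
    also have "\<dots> = of_nat (k choose h) * b ^ (k - h)"
      by (simp add: binomial_eq_0 sum.delta)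
    finally show ?thesis by (simp add: h)
  next
    case False
    then show ?thesis by (intro trans[OF sum.neutral]) auto
  qed
  finally show ?thesis .
qed

text \<open>
  Both sides are the coefficient of \<open>x^n\<close> in \<open>(1+x)^(2n) = ((1+x^2) + 2x)^n\<close>.
\<close>

lemma central_binomial_binomial_sum:
  "(2 * n) choose n = (\<Sum>k\<le>n. (n choose k) * 2 ^ (n - k) * aerated_central k)"
proof -
  have "[:1, 1::int:] ^ (2 * n) = ([:1, 0, 1:] + [:0, 2:]) ^ n"
    by (simp add: power_mult power2_eq_square)
  also have "\<dots> = (\<Sum>k\<le>n. of_nat (n choose k) * [:1, 0, 1:] ^ k * [:0, 2:] ^ (n - k))"
    by (rule binomial_ring)
  also have "\<dots> = (\<Sum>k\<le>n. smult (of_nat (n choose k) * 2 ^ (n - k)) (monom 1 (n - k) * [:1, 0, 1:] ^ k))"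
  proof (intro sum.cong refl)
    fix k
    have "[:0, 2::int:] ^ (n - k) = smult (2 ^ (n - k)) (monom 1 (n - k))"
      by (simp add: monom_altdef flip: smult_power)
    then show "of_nat (n choose k) * [:1, 0, 1:] ^ k * [:0, 2::int:] ^ (n - k)
        = smult (of_nat (n choose k) * 2 ^ (n - k)) (monom 1 (n - k) * [:1, 0, 1:] ^ k)"
      by (simp add: of_nat_poly mult.commute)
  qed
  finally have *: "coeff ([:1, 1::int:] ^ (2 * n)) n
      = (\<Sum>k\<le>n. of_nat (n choose k) * 2 ^ (n - k) * coeff ([:1, 0, 1:] ^ k) k)"
    by (auto simp: coeff_sum coeff_monom_mult intro!: sum.cong)
  have "coeff ([:1, 1::int:] ^ (2 * n)) n = of_nat ((2 * n) choose n)"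
    using coeff_linear_poly_power[of n "2 * n" 1 "1::int"] by simp
  moreover have "coeff ([:1, 0, 1::int:] ^ k) k = of_nat (aerated_central k)" for k
    by (simp add: coeff_shifted_square_power aerated_central_def)
  ultimately have "int ((2 * n) choose n) = int (\<Sum>k\<le>n. (n choose k) * 2 ^ (n - k) * aerated_central k)"
    using * by simp
  then show ?thesis by (simp only: of_nat_eq_iff)
qed

text \<open>
  For \<open>n = 2m\<close> only \<open>k = 2i\<close> contributes. The multinomial coefficient \<open>(2m)! / (i!^2 (m-i)!^2)\<close>
  that arises is also \<open>((2m) choose m) (m choose i)^2\<close>, and the squares sum to another central
  binomial coefficient.
\<close>

lemma aerated_central_self_convolution:
  "(\<Sum>k\<le>n. (n choose k) * aerated_central k * aerated_central (n - k)) = aerated_central n ^ 2"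
proof (cases "even n")
  case False
  have "aerated_central k * aerated_central (n - k) = 0" if "k \<le> n" for k
    using False that by (auto simp: aerated_central_def)
  then show ?thesis using False by (simp add: aerated_central_def mult.assoc)
next
  case True
  then obtain m where m: "n = 2 * m" by blast
  have eq: "((2 * m) choose (2 * i)) * ((2 * i) choose i) * ((2 * (m - i)) choose (m - i))
      = ((2 * m) choose m) * (m choose i) ^ 2" if "i \<le> m" for i
  proof -
    have "2 * m - 2 * i = 2 * (m - i)" "2 * (m - i) - (m - i) = m - i" using that by simp_all
    then have "real (((2 * m) choose (2 * i)) * ((2 * i) choose i) * ((2 * (m - i)) choose (m - i)))
        = real (((2 * m) choose m) * (m choose i) ^ 2)"
      using that by (simp add: binomial_fact power2_eq_square del: diff_diff_left diff_diff_right)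
    then show ?thesis by (simp only: of_nat_eq_iff)
  qed
  have "(\<Sum>k\<le>n. (n choose k) * aerated_central k * aerated_central (n - k))
      = (\<Sum>k\<in>(\<lambda>i. 2 * i) ` {..m}. (n choose k) * aerated_central k * aerated_central (n - k))"
  proof (rule sum.mono_neutral_right)
    show "\<forall>k\<in>{..n} - (\<lambda>i. 2 * i) ` {..m}. (n choose k) * aerated_central k * aerated_central (n - k) = 0"
      by (auto simp: m aerated_central_def image_iff elim!: evenE)
  qed (auto simp: m)
  also have "\<dots> = (\<Sum>i\<le>m. ((2 * m) choose (2 * i)) * ((2 * i) choose i) * ((2 * (m - i)) choose (m - i)))"
    by (subst sum.reindex) (simp_all add: inj_on_def m aerated_central_def flip: diff_mult_distrib2)
  also have "\<dots> = ((2 * m) choose m) * (\<Sum>i\<le>m. (m choose i) ^ 2)"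
    unfolding sum_distrib_left by (intro sum.cong refl eq) simp
  also have "\<dots> = aerated_central n ^ 2"
    unfolding choose_square_sum by (simp add: m aerated_central_def power2_eq_square)
  finally show ?thesis .
qed

section \<open>Exponential generating functions\<close>

definition egf :: "(nat \<Rightarrow> nat) \<Rightarrow> real fps" where
  "egf f = Abs_fps (\<lambda>n. real (f n) / fact n)"

lemma egf_mult: "egf f * egf g = egf (\<lambda>n. \<Sum>k\<le>n. (n choose k) * f k * g (n - k))"
proof (rule fps_ext)
  fix n
  have "fps_nth (egf f * egf g) n = (\<Sum>k\<le>n. real (f k) / fact k * (real (g (n - k)) / fact (n - k)))"
    by (simp add: egf_def fps_mult_nth atLeast0AtMost)
  also have "\<dots> = (\<Sum>k\<le>n. real ((n choose k) * f k * g (n - k)) / fact n)"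
    by (intro sum.cong refl) (simp add: binomial_fact)
  finally show "fps_nth (egf f * egf g) n = fps_nth (egf (\<lambda>n. \<Sum>k\<le>n. (n choose k) * f k * g (n - k))) n"
    by (simp add: egf_def sum_divide_distrib)
qed

lemma egf_power: "egf (\<lambda>n. a ^ n) = fps_exp (real a)"
  by (simp add: egf_def fps_exp_def)

lemma egf_inject: "egf f = egf g \<longleftrightarrow> f = g"
  by (auto simp: egf_def fps_eq_iff)

text \<open>
  This is the identity \<open>(e^(2x) I)^2 = e^(4x) I^2\<close> of exponential generating functions, read off
  coefficientwise.
\<close>

lemma S_binomial_sum:
  "S n = (\<Sum>k\<le>n. (n choose k) * 4 ^ (n - k) * aerated_central k ^ 2)"
proof -
  let ?I = "egf aerated_central"
  have "S = (\<lambda>n. \<Sum>k\<le>n. (n choose k) * ((2 * k) choose k) * ((2 * (n - k)) choose (n - k)))"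
    by (simp add: S_def atLeast0AtMost diff_mult_distrib2 fun_eq_iff)
  then have "egf S = egf (\<lambda>n. (2 * n) choose n) * egf (\<lambda>n. (2 * n) choose n)"
    by (simp add: egf_mult)
  also have "egf (\<lambda>n. (2 * n) choose n) = ?I * egf (\<lambda>n. 2 ^ n)"
    unfolding egf_mult central_binomial_binomial_sum by (simp add: mult_ac)
  also have "(?I * egf (\<lambda>n. 2 ^ n)) * (?I * egf (\<lambda>n. 2 ^ n)) = (?I * ?I) * egf (\<lambda>n. 4 ^ n)"
    by (simp add: egf_power mult_ac flip: fps_exp_add_mult[of 2 2, simplified])
  also have "?I * ?I = egf (\<lambda>n. aerated_central n ^ 2)"
    by (simp add: egf_mult aerated_central_self_convolution)
  also have "\<dots> * egf (\<lambda>n. 4 ^ n) = egf (\<lambda>n. \<Sum>k\<le>n. (n choose k) * 4 ^ (n - k) * aerated_central k ^ 2)"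
    unfolding egf_mult by (simp add: mult_ac)
  finally show ?thesis by (simp add: egf_inject fun_eq_iff)
qed

section \<open>The functional representing S\<close>

text \<open>
  The expectation of \<open>p(XY)\<close> for independent \<open>X\<close> and \<open>Y\<close> with the arcsine distribution on
  \<open>[-1, 1]\<close>. It is given through its moments, which makes it a finite sum and lets all the
  arguments stay algebraic.
\<close>

definition arcsine_mean :: "real poly \<Rightarrow> real" where
  "arcsine_mean p = (\<Sum>j\<le>degree p. coeff p j * (real (aerated_central j) ^ 2 / 4 ^ j))"

text \<open>
  A summation range independent of the degree is what makes additivity visible: the degree of a
  sum can drop below those of the summands.
\<close>

lemma arcsine_mean_eq_sum:
  assumes "degree p \<le> N"
  shows "arcsine_mean p = (\<Sum>j\<le>N. coeff p j * (real (aerated_central j) ^ 2 / 4 ^ j))"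
  unfolding arcsine_mean_def using assms
  by (intro sum.mono_neutral_left) (auto simp: coeff_eq_0)

lemma arcsine_mean_0: "arcsine_mean 0 = 0"
  by (simp add: arcsine_mean_def)

lemma arcsine_mean_add: "arcsine_mean (p + q) = arcsine_mean p + arcsine_mean q"
proof -
  let ?N = "max (degree p) (degree q)"
  have "degree (p + q) \<le> ?N" by (rule degree_add_le_max)
  then show ?thesis
    by (simp add: arcsine_mean_eq_sum[of _ ?N] algebra_simps sum.distrib add_divide_distrib)
qed

lemma arcsine_mean_smult: "arcsine_mean (smult a p) = a * arcsine_mean p"
  by (simp add: arcsine_mean_eq_sum[of _ "degree p"] degree_smult_le sum_distrib_left mult.assoc)

lemma arcsine_mean_sum: "arcsine_mean (\<Sum>k\<in>A. f k) = (\<Sum>k\<in>A. arcsine_mean (f k))"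
  by (induction A rule: infinite_finite_induct) (auto simp: arcsine_mean_add arcsine_mean_0)

text \<open>
  All odd moments vanish. This symmetry drives the second identity.
\<close>

lemma arcsine_mean_reflect: "arcsine_mean (p \<circ>\<^sub>p [:0, -1:]) = arcsine_mean p"
proof -
  have c: "coeff (p \<circ>\<^sub>p [:0, -1:]) j = (-1) ^ j * coeff p j" for j
    using coeff_pcompose_linear[of p "-1" j] by simp
  have "degree (p \<circ>\<^sub>p [:0, -1:]) = degree p"
    by (simp add: degree_pcompose)
  then show ?thesis unfolding arcsine_mean_def
    by (intro sum.cong) (auto simp: c aerated_central_def)
qed

lemma arcsine_mean_monom: "arcsine_mean (monom 1 n) = real (aerated_central n) ^ 2 / 4 ^ n"
proof -
  have "arcsine_mean (monom 1 n) = (\<Sum>j\<le>n. if j = n then real (aerated_central j) ^ 2 / 4 ^ j else 0)"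
    unfolding arcsine_mean_eq_sum[OF degree_monom_le] by (intro sum.cong) auto
  then show ?thesis by simp
qed

lemma arcsine_mean_one_plus_power: "arcsine_mean ([:1, 1:] ^ n) = real (S n) / 4 ^ n"
proof -
  have "arcsine_mean ([:1, 1:] ^ n) = (\<Sum>j\<le>n. coeff ([:1, 1:] ^ n) j * (real (aerated_central j) ^ 2 / 4 ^ j))"
    by (intro arcsine_mean_eq_sum) (simp add: degree_linear_power)
  also have "\<dots> = (\<Sum>j\<le>n. real ((n choose j) * 4 ^ (n - j) * aerated_central j ^ 2) / 4 ^ n)"
  proof (intro sum.cong refl)
    fix j assume "j \<in> {..n}"
    then have "(4::real) ^ (n - j) = 4 ^ n / 4 ^ j" by (simp add: power_diff)
    then show "coeff ([:1, 1:] ^ n) j * (real (aerated_central j) ^ 2 / 4 ^ j)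
        = real ((n choose j) * 4 ^ (n - j) * aerated_central j ^ 2) / 4 ^ n"
      using \<open>j \<in> {..n}\<close> by (simp add: coeff_linear_poly_power)
  qed
  finally show ?thesis by (simp add: S_binomial_sum sum_divide_distrib)
qed

lemma arcsine_mean_half_power: "arcsine_mean ([:1/2, 1/2:] ^ n) = real (S n) / 8 ^ n"
proof -
  have "[:1/2, 1/2::real:] = smult (1/2) [:1, 1:]" by simp
  then have "[:1/2, 1/2::real:] ^ n = smult ((1/2) ^ n) ([:1, 1:] ^ n)"
    by (simp only: smult_power)
  then show ?thesis
    by (simp add: arcsine_mean_smult arcsine_mean_one_plus_power power_divide flip: power_mult_distrib)
qed

section \<open>Alternating binomial transforms of S\<close>

lemma pcompose_power:
  fixes p q :: "'a::comm_ring_1 poly"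
  shows "(p ^ n) \<circ>\<^sub>p q = (p \<circ>\<^sub>p q) ^ n"
  by (induction n) (simp_all add: pcompose_mult pcompose_1)

lemma alternating_binomial_power:
  fixes p :: "'a::comm_ring_1 poly"
  shows "(\<Sum>k\<le>n. smult (of_nat (n choose k) * (-1) ^ k) (p ^ k)) = (1 - p) ^ n"
proof -
  have "(1 - p) ^ n = (- p + 1) ^ n" by simp
  also have "\<dots> = (\<Sum>k\<le>n. of_nat (n choose k) * (- p) ^ k)"
    by (subst binomial_ring) simp
  also have "\<dots> = (\<Sum>k\<le>n. smult (of_nat (n choose k) * (-1) ^ k) (p ^ k))"
  proof (intro sum.cong refl)
    fix k
    have "(- p) ^ k = smult ((-1) ^ k) (p ^ k)"
      using smult_power[of "-1" p k] by simp
    then show "of_nat (n choose k) * (- p) ^ k = smult (of_nat (n choose k) * (-1) ^ k) (p ^ k)"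
      by (simp add: of_nat_poly mult.commute)
  qed
  finally show ?thesis by simp
qed

lemma S_alternating_binomial_transform:
  "(\<Sum>k\<le>n. real (n choose k) * (-1) ^ k * 4 ^ (n - k) * real (S k)) = real (aerated_central n) ^ 2"
proof -
  have "(\<Sum>k\<le>n. real (n choose k) * (-1) ^ k * 4 ^ (n - k) * real (S k))
      = 4 ^ n * (\<Sum>k\<le>n. real (n choose k) * (-1) ^ k * arcsine_mean ([:1, 1:] ^ k))"
    unfolding sum_distrib_left arcsine_mean_one_plus_power
    by (intro sum.cong refl) (simp add: power_diff)
  also have "\<dots> = 4 ^ n * arcsine_mean ((1 - [:1, 1:]) ^ n)"
    by (simp flip: alternating_binomial_power add: arcsine_mean_sum arcsine_mean_smult)
  also have "(1 - [:1, 1::real:]) ^ n = monom 1 n \<circ>\<^sub>p [:0, -1:]"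
    by (simp add: one_pCons monom_altdef pcompose_power pcompose_pCons)
  finally show ?thesis by (simp add: arcsine_mean_reflect arcsine_mean_monom)
qed

text \<open>
  With \<open>q = (1+t)/2\<close> the sum is the functional at \<open>(1-q)^n\<close>, and \<open>1-q\<close> is \<open>q\<close> reflected.
\<close>

lemma S_self_inverse:
  "(\<Sum>k\<le>n. real (n choose k) * (-1) ^ k * (real (S k) / 8 ^ k)) = real (S n) / 8 ^ n"
proof -
  have "(\<Sum>k\<le>n. real (n choose k) * (-1) ^ k * (real (S k) / 8 ^ k)) = arcsine_mean ((1 - [:1/2, 1/2:]) ^ n)"
    by (simp flip: alternating_binomial_power arcsine_mean_half_power add: arcsine_mean_sum arcsine_mean_smult)
  also have "(1 - [:1/2, 1/2::real:]) ^ n = [:1/2, 1/2:] ^ n \<circ>\<^sub>p [:0, -1:]"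
    by (simp add: one_pCons pcompose_power pcompose_pCons)
  finally show ?thesis by (simp add: arcsine_mean_reflect arcsine_mean_half_power)
qed

section \<open>Legendre polynomials\<close>

lemma pochhammer_Suc_eq_choose:
  "pochhammer (of_nat (Suc j)) n = (fact n * of_nat ((n + j) choose n) :: real)"
proof -
  have "fact (n + j) = fact j * (pochhammer (of_nat (Suc j)) n :: real)"
    using pochhammer_product'[of "1::real" j n] by (simp add: pochhammer_fact add.commute)
  then show ?thesis by (simp add: binomial_fact)
qed

text \<open>
  The polynomial \<open>P n (1 + 2x)\<close>, where \<open>P n\<close> is the Legendre polynomial of degree \<open>n\<close>.
\<close>

definition shifted_legendre :: "nat \<Rightarrow> real poly" where
  "shifted_legendre n = (\<Sum>k\<le>n. monom (real (n choose k) * real ((n + k) choose k)) k)"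

lemma coeff_shifted_legendre:
  "coeff (shifted_legendre n) k = real (n choose k) * real ((n + k) choose k)"
  by (simp add: shifted_legendre_def coeff_sum sum.delta binomial_eq_0)

text \<open>
  Rodrigues' formula, with the derivative taken of \<open>x^n (1+x)^n\<close>: differentiating the term
  \<open>(n choose k) x^(n+k)\<close> of its expansion \<open>n\<close> times yields the factor \<open>n! ((n+k) choose k)\<close>.
\<close>

lemma shifted_legendre_rodrigues:
  "smult (fact n) (shifted_legendre n) = (pderiv ^^ n) ([:0, 1:] ^ n * [:1, 1:] ^ n)"
proof (rule poly_eqI)
  fix k
  have "[:0, 1::real:] ^ n = monom 1 n" by (simp add: monom_altdef)
  then have "coeff ((pderiv ^^ n) ([:0, 1::real:] ^ n * [:1, 1:] ^ n)) k
      = pochhammer (real (Suc k)) n * coeff ([:1, 1:] ^ n) k"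
    by (simp add: coeff_higher_pderiv coeff_monom_mult)
  also have "coeff ([:1, 1::real:] ^ n) k = real (n choose k)"
    by (cases "k \<le> n")
      (simp_all add: coeff_linear_poly_power binomial_eq_0 coeff_eq_0 degree_linear_power)
  finally show "coeff (smult (fact n) (shifted_legendre n)) k
      = coeff ((pderiv ^^ n) ([:0, 1:] ^ n * [:1, 1:] ^ n)) k"
    using binomial_symmetric[of n "n + k"]
    by (simp add: coeff_shifted_legendre pochhammer_Suc_eq_choose del: of_nat_Suc)
qed

lemma higher_pderiv_pcompose_linear:
  fixes p :: "'a::idom poly"
  shows "(pderiv ^^ n) (p \<circ>\<^sub>p [:a, b:]) = smult (b ^ n) ((pderiv ^^ n) p \<circ>\<^sub>p [:a, b:])"
  by (induction n) (simp_all add: pderiv_smult pderiv_pcompose pderiv_pCons mult.commute)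

text \<open>
  The substitution \<open>x = -(1+t)/2\<close> turns \<open>x^n (1+x)^n\<close> into \<open>((t^2-1)/4)^n\<close>. Since it is affine it
  commutes with differentiation up to powers of \<open>-1/2\<close>, so Rodrigues' formula gives the
  coefficients in the new variable \<open>t\<close>.
\<close>

lemma coeff_legendre_centred:
  "coeff (shifted_legendre n \<circ>\<^sub>p [:- (1/2), - (1/2):]) j
    = (-1/2) ^ n * real ((n + j) choose n) * coeff ([:-1, 0, 1:] ^ n) (n + j)"
proof -
  let ?g = "[:- (1/2), - (1/2)::real:]"
  have "([:0, 1:] ^ n * [:1, 1:] ^ n) \<circ>\<^sub>p ?g = [:- (1/2), - (1/2):] ^ n * [:1/2, -1/2:] ^ n"
    by (simp add: pcompose_mult pcompose_power pcompose_pCons)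
  also have "\<dots> = ([:- (1/2), - (1/2):] * [:1/2, -1/2:]) ^ n"
    by (rule power_mult_distrib[symmetric])
  also have "[:- (1/2), - (1/2):] * [:1/2, -1/2::real:] = smult (1/4) [:-1, 0, 1:]"
    by simp
  finally have h: "([:0, 1:] ^ n * [:1, 1:] ^ n) \<circ>\<^sub>p ?g = smult ((1/4) ^ n) ([:-1, 0, 1:] ^ n)"
    by (simp only: smult_power)
  have "smult ((-1/2) ^ n * fact n) (shifted_legendre n \<circ>\<^sub>p ?g)
      = smult ((-1/2) ^ n) ((pderiv ^^ n) ([:0, 1:] ^ n * [:1, 1:] ^ n) \<circ>\<^sub>p ?g)"
    by (simp flip: shifted_legendre_rodrigues add: pcompose_smult)
  also have "\<dots> = (pderiv ^^ n) (smult ((1/4) ^ n) ([:-1, 0, 1:] ^ n))"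
    by (simp flip: higher_pderiv_pcompose_linear h)
  finally have "(-1/2) ^ n * fact n * coeff (shifted_legendre n \<circ>\<^sub>p ?g) j
      = (1/4) ^ n * (fact n * real ((n + j) choose n) * coeff ([:-1, 0, 1:] ^ n) (n + j))"
    by (simp only: coeff_higher_pderiv coeff_smult pochhammer_Suc_eq_choose add.commute[of j] flip: coeff_smult)
       (simp add: mult_ac)
  moreover have "(1/4::real) ^ n = (-1/2) ^ n * (-1/2) ^ n"
    by (simp flip: power_mult_distrib)
  ultimately show ?thesis by simp
qed

text \<open>
  The power \<open>((1+t)/2)^k\<close> has mean \<open>S k / 8^k\<close>, so \<open>x = -(1+t)/2\<close> is the variable whose powers have
  means \<open>S k / (-8)^k\<close>.
\<close>

lemma S_legendre_transform_eq_arcsine_mean: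
  "(\<Sum>k\<le>n. real (n choose k) * real ((n + k) choose k) * (-8) ^ (n - k) * real (S k))
    = (-8) ^ n * arcsine_mean (shifted_legendre n \<circ>\<^sub>p [:- (1/2), - (1/2):])"
proof -
  have g: "[:- (1/2), - (1/2)::real:] ^ k = smult ((-1) ^ k) ([:1/2, 1/2:] ^ k)" for k
    by (simp flip: smult_power)
  have "shifted_legendre n \<circ>\<^sub>p [:- (1/2), - (1/2):]
      = (\<Sum>k\<le>n. smult (real (n choose k) * real ((n + k) choose k)) ([:- (1/2), - (1/2):] ^ k))"
    by (simp add: shifted_legendre_def monom_altdef pcompose_sum pcompose_smult pcompose_power pcompose_pCons)
  then have "arcsine_mean (shifted_legendre n \<circ>\<^sub>p [:- (1/2), - (1/2):])
      = (\<Sum>k\<le>n. real (n choose k) * real ((n + k) choose k) * ((-1) ^ k * (real (S k) / 8 ^ k)))"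
    by (simp only: g arcsine_mean_sum arcsine_mean_smult arcsine_mean_half_power)
  moreover have "(-8::real) ^ (n - k) = (-8) ^ n * ((-1) ^ k / 8 ^ k)" if "k \<le> n" for k
  proof -
    have "(-8::real) ^ k = (-1) ^ k * 8 ^ k" by (simp flip: power_mult_distrib)
    then show ?thesis using that by (simp add: power_diff field_simps flip: power_mult_distrib)
  qed
  ultimately show ?thesis
    by (simp add: sum_distrib_left mult_ac)
qed

section \<open>A balanced hypergeometric sum\<close>

text \<open>
  This is \<open>(2p) choose p\<close> times the \<open>i\<close>-th term of \<open>3F2(-p, p+1/2, 1/2; 1, 1; 1)\<close>, arranged as it
  arises from the coefficients of the Legendre polynomial of degree \<open>2p\<close> and the moments.
\<close>

definition saalschuetz_term :: "nat \<Rightarrow> nat \<Rightarrow> real" where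
  "saalschuetz_term p i = (-1/16) ^ i * real ((2 * p + 2 * i) choose (2 * p)) * real ((2 * p) choose (p + i))
     * real ((2 * i) choose i) ^ 2"

text \<open>
  Writing \<open>p = i + d\<close> removes the truncated subtraction from the factorials, so that the shifts
  \<open>p \<mapsto> p+1\<close> and \<open>i \<mapsto> i+1\<close> become rational factors.
\<close>

lemma saalschuetz_term_fact:
  "saalschuetz_term (i + d) i = (-1/16) ^ i * (fact (4 * i + 2 * d) * fact (2 * i)) / (fact d * fact (2 * i + d) * fact i ^ 4)"
proof -
  have "2 * (i + d) - (i + d + i) = d" by simp
  then show ?thesis
    by (simp add: saalschuetz_term_def binomial_fact power2_eq_square eval_nat_numeral add_ac)
qed

lemma saalschuetz_term_eq_0: "p < i \<Longrightarrow> saalschuetz_term p i = 0"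
  by (simp add: saalschuetz_term_def binomial_eq_0)

lemma fact_Suc_Suc: "fact (Suc (Suc m)) = (real m + 2) * ((real m + 1) * fact m)"
  by (simp add: algebra_simps)

lemma saalschuetz_term_Suc_left:
  assumes "i \<le> Suc p"
  shows "(real p + 1 - real i) * saalschuetz_term (Suc p) i = 2 * (2 * real p + 2 * real i + 1) * saalschuetz_term p i"
proof (cases "i = Suc p")
  case True
  then show ?thesis by (simp add: saalschuetz_term_eq_0)
next
  case False
  with assms obtain d where d: "p = i + d" using le_Suc_ex by (metis le_SucE)
  have 1: "fact (4 * i + 2 * Suc d) = (4 * real i + 2 * real d + 2) * ((4 * real i + 2 * real d + 1) * fact (4 * i + 2 * d))"
    by (simp add: algebra_simps)
  have 2: "fact (2 * i + Suc d) = (2 * real i + real d + 1) * fact (2 * i + d)"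
    by (simp add: algebra_simps)
  have 3: "fact (Suc d) = (real d + 1) * fact d" by simp
  have nz: "2 * real i + real d + 1 \<noteq> 0" "real d + 1 \<noteq> 0" by linarith+
  have "saalschuetz_term (i + Suc d) i = saalschuetz_term (i + d) i * ((4 * real i + 2 * real d + 2) * (4 * real i + 2 * real d + 1)
      / ((real d + 1) * (2 * real i + real d + 1)))"
    unfolding saalschuetz_term_fact 1 2 3 by (simp add: mult_ac)
  also have "(4 * real i + 2 * real d + 2) * (4 * real i + 2 * real d + 1) / ((real d + 1) * (2 * real i + real d + 1))
     = 2 * (4 * real i + 2 * real d + 1) / (real d + 1)"
    using nz by (simp add: divide_simps) algebra
  finally show ?thesis using nz by (simp add: d field_simps)
qed

lemma saalschuetz_term_Suc_right:
  assumes "i \<le> p"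
  shows "4 * (real i + 1) ^ 3 * saalschuetz_term p (Suc i)
    = - ((2 * real p + 2 * real i + 1) * (2 * real i + 1) * (real p - real i) * saalschuetz_term p i)"
proof (cases "i = p")
  case True
  then show ?thesis by (simp add: saalschuetz_term_eq_0)
next
  case False
  with assms obtain d where d: "p = Suc (i + d)"
    using less_iff_Suc_add by (metis le_neq_implies_less)
  have 1: "fact (4 * Suc i + 2 * d) = (4 * real i + 2 * real d + 4) * ((4 * real i + 2 * real d + 3) * fact (4 * i + 2 * Suc d))"
  proof -
    have "4 * Suc i + 2 * d = Suc (Suc (4 * i + 2 * Suc d))" by simp
    then show ?thesis by (simp only: fact_Suc_Suc) (simp add: algebra_simps del: fact_Suc)
  qed
  have 2: "fact (2 * Suc i + d) = (2 * real i + real d + 2) * fact (2 * i + Suc d)"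
    by (simp add: algebra_simps)
  have 3: "fact (Suc d) = (real d + 1) * fact d" by simp
  have 4: "fact (Suc i) = (real i + 1) * fact i" by simp
  have 5: "fact (2 * Suc i) = (2 * real i + 2) * ((2 * real i + 1) * fact (2 * i))"
    by (simp add: algebra_simps)
  have nz: "2 * real i + real d + 2 \<noteq> 0" "real d + 1 \<noteq> 0" "real i + 1 \<noteq> 0" by linarith+
  have "saalschuetz_term (Suc i + d) (Suc i) = saalschuetz_term (i + Suc d) i
      * ((-1/16) * ((4 * real i + 2 * real d + 4) * (4 * real i + 2 * real d + 3) * (2 * real i + 2) * (2 * real i + 1) * (real d + 1))
      / ((2 * real i + real d + 2) * (real i + 1) ^ 4))"
    unfolding saalschuetz_term_fact 1 2 3 4 5 using nz by (simp add: power_mult_distrib mult_ac)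
  also have "(-1/16) * ((4 * real i + 2 * real d + 4) * (4 * real i + 2 * real d + 3) * (2 * real i + 2) * (2 * real i + 1) * (real d + 1))
      / ((2 * real i + real d + 2) * (real i + 1) ^ 4)
     = - ((4 * real i + 2 * real d + 3) * (2 * real i + 1) * (real d + 1)) / (4 * (real i + 1) ^ 3)"
    using nz by (simp add: divide_simps) algebra
  finally show ?thesis using nz by (simp add: d field_simps)
qed

text \<open>
  The Wilf-Zeilberger pair for the recurrence
  \<open>2 (p+1)^3 A (p+1) = (2p+1)^3 A p\<close> satisfied by \<open>A p = ((2p) choose p)^3 / 16^p\<close>. The certificate
  \<open>G\<close> is a rational multiple of the term at \<open>p+1\<close> rather than at \<open>p\<close>: relative to the latter it
  would have the denominator \<open>p+1-i\<close>, which vanishes at the end of the range \<open>i = p+1\<close>. After the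
  two shift relations are used, the claim is a polynomial identity in \<open>p\<close> and \<open>i\<close>.
\<close>

lemma saalschuetz_term_telescope:
  assumes "i \<le> Suc p"
  defines "G \<equiv> \<lambda>i. - 2 * (4 * real p + 3) * real i ^ 3 * saalschuetz_term (Suc p) i / (2 * real p + 2 * real i + 1)"
  shows "2 * (real p + 1) ^ 3 * saalschuetz_term (Suc p) i - (2 * real p + 1) ^ 3 * saalschuetz_term p i = G (Suc i) - G i"
proof -
  define x y A where "x = real p" and "y = real i" and "A = saalschuetz_term (Suc p) i"
  have pos: "2 * x + 2 * y + 1 \<noteq> 0" "2 * x + 2 * y + 3 \<noteq> 0" 
    unfolding x_def y_def by linarith+
  have a: "saalschuetz_term p i = (x + 1 - y) * A / (2 * (2 * x + 2 * y + 1))"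
    using saalschuetz_term_Suc_left[OF assms(1)] pos by (simp add: x_def y_def A_def field_simps)
  have "4 * (y + 1) ^ 3 * saalschuetz_term (Suc p) (Suc i) = - ((2 * x + 2 * y + 3) * (2 * y + 1) * (x + 1 - y) * A)"
    using saalschuetz_term_Suc_right[OF assms(1)] by (simp add: x_def y_def A_def algebra_simps)
  moreover have "G (Suc i) * (2 * x + 2 * y + 3) = - 2 * (4 * x + 3) * (y + 1) ^ 3 * saalschuetz_term (Suc p) (Suc i)"
    using pos(2) unfolding G_def by (simp add: x_def y_def add_ac)
  ultimately have "G (Suc i) * (2 * x + 2 * y + 3)
      = ((4 * x + 3) * (2 * y + 1) * (x + 1 - y) * A / 2) * (2 * x + 2 * y + 3)"
    by simp algebra
  then have b: "G (Suc i) = (4 * x + 3) * (2 * y + 1) * (x + 1 - y) * A / 2"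
    using mult_right_cancel[OF pos(2)] by blast
  have c: "G i = - 2 * (4 * x + 3) * y ^ 3 * A / (2 * x + 2 * y + 1)"
    by (simp add: G_def x_def y_def A_def)
  have "2 * (x + 1) ^ 3 * A - (2 * x + 1) ^ 3 * ((x + 1 - y) * A / (2 * (2 * x + 2 * y + 1)))
      = (4 * x + 3) * (2 * y + 1) * (x + 1 - y) * A / 2 - (- 2 * (4 * x + 3) * y ^ 3 * A / (2 * x + 2 * y + 1))"
    using pos(1) by (simp add: divide_simps) algebra
  then show ?thesis unfolding a b c by (simp add: x_def y_def A_def)
qed

text \<open>
  Summing the telescoping relation over \<open>i \<le> p+1\<close> leaves only boundary values of the certificate,
  which vanish: at \<open>0\<close> because of the factor \<open>i^3\<close>, and at \<open>p+2\<close> because the term is zero there.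
\<close>

lemma sum_saalschuetz_term: "(\<Sum>i\<le>p. saalschuetz_term p i) = real ((2 * p) choose p) ^ 3 / 16 ^ p"
proof (induction p)
  case 0
  show ?case by (simp add: saalschuetz_term_def)
next
  case (Suc p)
  define G where "G = (\<lambda>i. - 2 * (4 * real p + 3) * real i ^ 3 * saalschuetz_term (Suc p) i / (2 * real p + 2 * real i + 1))"
  have "2 * (real p + 1) ^ 3 * (\<Sum>i\<le>Suc p. saalschuetz_term (Suc p) i) - (2 * real p + 1) ^ 3 * (\<Sum>i\<le>Suc p. saalschuetz_term p i)
      = (\<Sum>i\<le>Suc p. G (Suc i) - G i)"
    unfolding sum_distrib_left sum_subtractf[symmetric] G_def
    by (intro sum.cong refl saalschuetz_term_telescope) simp
  also have "\<dots> = G (Suc (Suc p)) - G 0"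
    unfolding lessThan_Suc_atMost[symmetric] by (rule sum_lessThan_telescope)
  also have "\<dots> = 0"
    by (simp add: G_def saalschuetz_term_eq_0)
  finally have rec: "2 * (real p + 1) ^ 3 * (\<Sum>i\<le>Suc p. saalschuetz_term (Suc p) i)
      = (2 * real p + 1) ^ 3 * (real ((2 * p) choose p) ^ 3 / 16 ^ p)"
    using Suc by (simp add: saalschuetz_term_eq_0)
  have "real ((2 * Suc p) choose Suc p) * (real p + 1) = 2 * (2 * real p + 1) * real ((2 * p) choose p)"
  proof -
    have "fact (2 * Suc p) = (2 * real p + 2) * ((2 * real p + 1) * fact (2 * p))"
      by (simp add: algebra_simps)
    moreover have "real ((2 * m) choose m) = fact (2 * m) / (fact m * fact m)" for m
      by (simp add: binomial_fact)
    moreover have "fact (Suc p) = (real p + 1) * fact p" by simp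
    moreover have "(2 * x + 2) * ((2 * x + 1) * F) / ((x + 1) * E * ((x + 1) * E)) * (x + 1)
        = 2 * (2 * x + 1) * (F / (E * E))" if "x + 1 \<noteq> 0" "E \<noteq> 0" for x E F :: real
      using that by (simp add: divide_simps) algebra
    moreover have "real p + 1 \<noteq> 0" by linarith
    ultimately show ?thesis by (simp only: fact_nonzero not_False_eq_True)
  qed
  then have "(real ((2 * Suc p) choose Suc p) * (real p + 1)) ^ 3
      = (2 * (2 * real p + 1) * real ((2 * p) choose p)) ^ 3"
    by (simp only:)
  then have "real ((2 * Suc p) choose Suc p) ^ 3 * (real p + 1) ^ 3
      = 8 * (2 * real p + 1) ^ 3 * real ((2 * p) choose p) ^ 3"
    unfolding power_mult_distrib by simp
  \<comment> \<open>The recurrence for the sum and the one for the cubed central binomial coefficient combine after cancelling \<open>P = (p+1)^3\<close>.\<close>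
  moreover have "\<Sigma> = B / 16 ^ Suc p"
    if "2 * P * \<Sigma> = Q * (C / 16 ^ p)" "B * P = 8 * Q * C" "P \<noteq> 0" for P Q B C \<Sigma> :: real
  proof -
    have "(\<Sigma> * 16 ^ Suc p) * P = B * P"
      unfolding that(2) using that(1) by (simp add: field_simps)
    with that(3) show ?thesis by (simp add: eq_divide_eq)
  qed
  moreover have "(real p + 1) ^ 3 \<noteq> 0" by simp
  ultimately show ?case using rec by blast
qed

section \<open>The three identities\<close>

text \<open>
  The Legendre polynomial has the parity of \<open>n\<close>. For odd \<open>n\<close> its mean is therefore zero, and for
  \<open>n = 2p\<close> the coefficient of \<open>t^(2i)\<close> times the moment of order \<open>2i\<close> is \<open>(-1/4)^p\<close> times the
  \<open>i\<close>-th term of the hypergeometric sum.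
\<close>

lemma S_legendre_transform:
  "(\<Sum>k\<le>n. real (n choose k) * real ((n + k) choose k) * (-8) ^ (n - k) * real (S k))
    = (if odd n then 0 else (-1) ^ (n div 2) * real (n choose (n div 2)) ^ 3)"
proof -
  let ?R = "shifted_legendre n \<circ>\<^sub>p [:- (1/2), - (1/2):]"
  let ?t = "\<lambda>j. coeff ?R j * (real (aerated_central j) ^ 2 / 4 ^ j)"
  have "degree (shifted_legendre n) \<le> n"
    by (rule degree_le) (simp add: coeff_shifted_legendre binomial_eq_0)
  then have "degree ?R \<le> n" by (simp add: degree_pcompose)
  then have m: "arcsine_mean ?R = (\<Sum>j\<le>n. ?t j)"
    by (rule arcsine_mean_eq_sum)
  show ?thesis
  proof (cases "even n")
    case False
    have "?t j = 0" for j
      using False by (cases "even j") (simp_all add: coeff_legendre_centred coeff_shifted_square_power aerated_central_def)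
    then show ?thesis using False by (simp only: S_legendre_transform_eq_arcsine_mean m) simp
  next
    case True
    then obtain p where p: "n = 2 * p" by blast
    have "(\<Sum>j\<le>n. ?t j) = (\<Sum>j\<in>(\<lambda>i. 2 * i) ` {..p}. ?t j)"
      by (rule sum.mono_neutral_right) (auto simp: p aerated_central_def image_iff elim!: evenE)
    also have "\<dots> = (\<Sum>i\<le>p. ?t (2 * i))"
      by (subst sum.reindex) (auto simp: inj_on_def)
    also have "\<dots> = (\<Sum>i\<le>p. (-1) ^ p / 4 ^ p * saalschuetz_term p i)"
    proof (intro sum.cong refl)
      fix i assume "i \<in> {..p}"
      then have i: "i \<le> p" by simp
      have "(-1::real) ^ (p - i) = (-1) ^ p * (-1) ^ i"
        using i by (simp add: minus_one_power_iff)
      moreover have "(n + 2 * i) div 2 = p + i" "n - (p + i) = p - i" "even (n + 2 * i)"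
        by (simp_all add: p)
      ultimately have "coeff ?R (2 * i)
          = (-1/2) ^ n * real ((n + 2 * i) choose n) * (real (n choose (p + i)) * ((-1) ^ p * (-1) ^ i))"
        unfolding coeff_legendre_centred coeff_shifted_square_power by simp
      moreover have "(-1/2::real) ^ n = 1 / 4 ^ p"
        by (simp add: p power_mult power_divide power2_eq_square)
      moreover have "(-1/16::real) ^ i = (-1) ^ i / 4 ^ (2 * i)"
        by (simp only: power_divide power_mult) simp
      ultimately show "?t (2 * i) = (-1) ^ p / 4 ^ p * saalschuetz_term p i"
        by (simp add: aerated_central_def saalschuetz_term_def p)
    qed
    finally have "arcsine_mean ?R = (-1) ^ p / 4 ^ p * (real ((2 * p) choose p) ^ 3 / 16 ^ p)"
      unfolding m sum_distrib_left[symmetric] sum_saalschuetz_term .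
    moreover have "(-8::real) ^ n = 4 ^ p * 16 ^ p"
      by (simp add: p power_mult flip: power_mult_distrib)
    ultimately show ?thesis by (simp add: S_legendre_transform_eq_arcsine_mean p)
  qed
qed

theorem theorem3p1:
  fixes n :: nat
  shows "((\<Sum>k=0..n. int (n choose k) * (-1) ^ k * 4 ^ (n - k) * int (S k))
           = (if odd n then 0 else (int (n choose (n div 2))) ^ 2))
       \<and> ((\<Sum>k=0..n. real (n choose k) * (-1) ^ k * (real (S k) / 8 ^ k)) = real (S n) / 8 ^ n)
       \<and> ((\<Sum>k=0..n. int (n choose k) * int ((n + k) choose k) * (-8) ^ (n - k) * int (S k))
           = (if odd n then 0 else (-1) ^ (n div 2) * (int (n choose (n div 2))) ^ 3))"
proof (intro conjI)
  have "real_of_int (\<Sum>k=0..n. int (n choose k) * (-1) ^ k * 4 ^ (n - k) * int (S k))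
      = real_of_int (if odd n then 0 else (int (n choose (n div 2))) ^ 2)"
    using S_alternating_binomial_transform[of n] by (simp add: atLeast0AtMost aerated_central_def)
  then show "(\<Sum>k=0..n. int (n choose k) * (-1) ^ k * 4 ^ (n - k) * int (S k))
      = (if odd n then 0 else (int (n choose (n div 2))) ^ 2)"
    by (simp only: of_int_eq_iff)
next
  show "(\<Sum>k=0..n. real (n choose k) * (-1) ^ k * (real (S k) / 8 ^ k)) = real (S n) / 8 ^ n"
    using S_self_inverse[of n] by (simp add: atLeast0AtMost)
next
  have "real_of_int (\<Sum>k=0..n. int (n choose k) * int ((n + k) choose k) * (-8) ^ (n - k) * int (S k))
      = real_of_int (if odd n then 0 else (-1) ^ (n div 2) * (int (n choose (n div 2))) ^ 3)"
    using S_legendre_transform[of n] by (simp add: atLeast0AtMost)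
  then show "(\<Sum>k=0..n. int (n choose k) * int ((n + k) choose k) * (-8) ^ (n - k) * int (S k))
      = (if odd n then 0 else (-1) ^ (n div 2) * (int (n choose (n div 2))) ^ 3)"
    by (simp only: of_int_eq_iff)
qed

end
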